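(* Let $s,k,n$ be natural numbers with $s\le n$ and $k\le n$, and let $\mathcal Q_{s,k,n}(t_1,\dots,t_k)=\sum_{\lambda} c_\lambda\, t_{\lambda_1}t_{\lambda_2}\cdots t_{\lambda_d}$ be the polynomial defined in the context, where the sum runs over all integer partitions $\lambda=(\lambda_1\ge\lambda_2\ge\dots\ge\lambda_d\ge1)$ of $k$. For such a partition $\lambda$ with $d$ parts, let $\delta_1,\dots,\delta_q$ be the multiplicities of the distinct values among $\lambda_1,\dots,\lambda_d$ (so $\delta_1+\dots+\delta_q=d$). Then $$c_\lambda=\frac{(-1)^{s+d}\,k!}{\lambda_1!\cdots\lambda_d!\,\delta_1!\cdots\delta_q!}\sum_{p=0}^{s}\ \sum_{\substack{m_1,\dots,m_d\ge1\\ m_1+\dots+m_d=s-p}}(-1)^p\binom np\, m_1^{\lambda_1-1}\cdots m_d^{\lambda_d-1},$$ where the inner sum is over all sequences of $d$ positive integers with sum $s-p$ (an empty inner sum is $0$).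
   Context: For a multiset $A=\{a_1,\dots,a_n\}$ of $n$ complex numbers, $\mathfrak p_j(A)=\sum_{i=1}^n a_i^j$ is its $j$-th power sum, and for $s\le n$, $A^{(s)}$ denotes the multiset of all $\binom ns$ sums $a_{i_1}+\dots+a_{i_s}$ with $1\le i_1<\dots<i_s\le n$ (counted with multiplicity). For $s,k\le n$, $\mathcal Q_{s,k,n}(t_1,\dots,t_k)$ is the unique polynomial with rational coefficients such that for every $n$-multiset $A$ of complex numbers, $\mathfrak p_k(A^{(s)})=\mathcal Q_{s,k,n}(\mathfrak p_1(A),\dots,\mathfrak p_k(A))$ (uniqueness holds because $\mathfrak p_1,\dots,\mathfrak p_n$ are algebraically independent in $n$ variables). $c_\lambda$ is the coefficient of the monomial $t_{\lambda_1}\cdots t_{\lambda_d}$ in $\mathcal Q_{s,k,n}$. *)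

theory Defs
  imports Complex_Main "HOL-Library.Multiset" "HOL-Library.Poly_Mapping"
    "HOL-Combinatorics.List_Permutation"
begin

definition power_sum :: "nat \<Rightarrow> complex multiset \<Rightarrow> complex" where
  "power_sum j A = (\<Sum>x\<in>#A. x ^ j)"

definition list_subset_sums :: "nat \<Rightarrow> complex list \<Rightarrow> complex multiset" where
  "list_subset_sums s xs =
     image_mset (\<lambda>I. \<Sum>i\<in>I. xs ! i) (mset_set {I. I \<subseteq> {..<length xs} \<and> card I = s})"

(* The multiset A^(s), computed from an enumeration of A; by subset_sums_mset
   below, the choice of the enumeration is irrelevant. *)
definition subset_sums :: "nat \<Rightarrow> complex multiset \<Rightarrow> complex multiset" where
  "subset_sums s A = list_subset_sums s (SOME xs. mset xs = A)"

lemma list_subset_sums_perm: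
  assumes "mset xs = mset ys"
  shows "list_subset_sums s xs = list_subset_sums s ys"
proof -
  have len: "length xs = length ys"
    using assms by (rule mset_eq_length)
  obtain f where f: "f permutes {..<length ys}" and xs: "permute_list f ys = xs"
    using assms by (rule mset_eq_permutation)
  let ?S = "{I. I \<subseteq> {..<length ys} \<and> card I = s}"
  have inj: "inj f" and img: "f ` {..<length ys} = {..<length ys}"
    using f by (simp_all add: permutes_inj permutes_image)
  have inj_img: "inj_on ((`) f) ?S"
    using inj by (simp add: inj_on_def inj_image_eq_iff)
  have img_S: "((`) f) ` ?S = ?S"
  proof (rule card_subset_eq)
    show "finite ?S" by simp
    show "((`) f) ` ?S \<subseteq> ?S"
    proof
      fix J assume "J \<in> ((`) f) ` ?S"
      then obtain I where I: "I \<subseteq> {..<length ys}" "card I = s" "J = f ` I" by auto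
      have "f ` I \<subseteq> f ` {..<length ys}" using I(1) by (rule image_mono)
      moreover have "card (f ` I) = s"
        using I(2) inj by (simp add: card_image inj_on_subset[OF inj])
      ultimately show "J \<in> ?S" using I(3) img by simp
    qed
    show "card (((`) f) ` ?S) = card ?S" using inj_img by (rule card_image)
  qed
  have "(\<Sum>i\<in>f ` I. ys ! i) = (\<Sum>i\<in>I. xs ! i)" if "I \<in> ?S" for I
  proof -
    have "(\<Sum>i\<in>f ` I. ys ! i) = (\<Sum>i\<in>I. ys ! f i)"
      by (subst sum.reindex) (auto intro: inj_on_subset[OF inj])
    also have "\<dots> = (\<Sum>i\<in>I. xs ! i)"
      using that f xs by (intro sum.cong) (auto simp: permute_list_nth)
    finally show ?thesis .
  qed
  then have "image_mset (\<lambda>I. \<Sum>i\<in>I. xs ! i) (mset_set ?S) =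
      image_mset (\<lambda>I. \<Sum>i\<in>f ` I. ys ! i) (mset_set ?S)"
    by (intro image_mset_cong) simp
  also have "\<dots> = image_mset (\<lambda>I. \<Sum>i\<in>I. ys ! i) (image_mset ((`) f) (mset_set ?S))"
    by (simp add: multiset.map_comp comp_def)
  also have "image_mset ((`) f) (mset_set ?S) = mset_set ?S"
    using inj_img img_S by (simp add: image_mset_mset_set)
  finally show ?thesis
    by (simp add: list_subset_sums_def len)
qed

lemma subset_sums_mset: "subset_sums s (mset xs) = list_subset_sums s xs"
  unfolding subset_sums_def
  by (rule list_subset_sums_perm, rule someI_ex) (rule exI[of _ xs], simp)

(* Rational polynomials in the indeterminates t_i (i a natural number):
   finitely supported maps from exponent vectors to coefficients. *)
type_synonym rat_mpoly = "(nat \<Rightarrow>\<^sub>0 nat) \<Rightarrow>\<^sub>0 rat"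

definition mpoly_vars :: "rat_mpoly \<Rightarrow> nat set" where
  "mpoly_vars P = (\<Union>m\<in>Poly_Mapping.keys P. Poly_Mapping.keys m)"

definition mpoly_eval :: "(nat \<Rightarrow> complex) \<Rightarrow> rat_mpoly \<Rightarrow> complex" where
  "mpoly_eval t P =
     (\<Sum>m\<in>Poly_Mapping.keys P. of_rat (Poly_Mapping.lookup P m) *
        (\<Prod>i\<in>Poly_Mapping.keys m. t i ^ Poly_Mapping.lookup m i))"

definition expresses_subset_power_sum :: "nat \<Rightarrow> nat \<Rightarrow> nat \<Rightarrow> rat_mpoly \<Rightarrow> bool" where
  "expresses_subset_power_sum s k n P \<longleftrightarrow>
     mpoly_vars P \<subseteq> {1..k} \<and>
     (\<forall>A :: complex multiset. size A = n \<longrightarrow>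
        power_sum k (subset_sums s A) = mpoly_eval (\<lambda>j. power_sum j A) P)"

definition Q_poly :: "nat \<Rightarrow> nat \<Rightarrow> nat \<Rightarrow> rat_mpoly" where
  "Q_poly s k n = (THE P. expresses_subset_power_sum s k n P)"

definition partitions :: "nat \<Rightarrow> nat list set" where
  "partitions k = {l. sorted_wrt (\<ge>) l \<and> (\<forall>i\<in>set l. 1 \<le> i) \<and> sum_list l = k}"

(* The exponent vector of the monomial t_{l_1} ... t_{l_d}. *)
definition partition_exponent :: "nat list \<Rightarrow> (nat \<Rightarrow>\<^sub>0 nat)" where
  "partition_exponent l = (\<Sum>i\<leftarrow>l. Poly_Mapping.single i 1)"

definition Q_coeff :: "nat \<Rightarrow> nat \<Rightarrow> nat \<Rightarrow> nat list \<Rightarrow> rat" where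
  "Q_coeff s k n l = Poly_Mapping.lookup (Q_poly s k n) (partition_exponent l)"

definition compositions :: "nat \<Rightarrow> nat \<Rightarrow> nat list set" where
  "compositions d r = {m. length m = d \<and> (\<forall>x\<in>set m. 1 \<le> x) \<and> sum_list m = r}"

(* Finiteness, so that sums over these sets are genuine sums. *)
lemma finite_compositions: "finite (compositions d r)"
proof (rule finite_subset)
  show "compositions d r \<subseteq> {m. set m \<subseteq> {..r} \<and> length m = d}"
    by (auto simp: compositions_def member_le_sum_list)
qed (simp add: finite_lists_length_eq)

lemma finite_partitions: "finite (partitions k)"
proof (rule finite_subset)
  have "length l \<le> sum_list l" if "\<forall>i\<in>set l. 1 \<le> i" for l :: "nat list"
    using that by (induction l) auto
  then show "partitions k \<subseteq> {l. set l \<subseteq> {..k} \<and> length l \<le> k}"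
    by (auto simp: partitions_def member_le_sum_list)
qed (simp add: finite_lists_length_le)

end

theory Submission
  imports Defs "HOL-Computational_Algebra.Computational_Algebra"
    "HOL-Combinatorics.Multiset_Permutations"
begin

text \<open>
  Up to sign and a factor k!, the power sum of order k of A^(s) is the coefficient of y^s z^k in the
  product of the factors 1 - y e^(a z) over a in A. Expanding log((1 - y e^(a z)) / (1 - y)) in
  powers of y turns this product into (1 - y)^n exp(-B), where B is the sum over j \<ge> 1 and m \<ge> 1 of
  p_j(A) m^(j-1) y^m z^j / j!; the exponential series then runs over compositions of k, which
  are grouped into partitions. To avoid logarithms, both sides are seen to solve the same linear
  differential equation in z. Uniqueness of the polynomial holds because, by Newton's identities
  and the fundamental theorem of algebra, the first n power sums take arbitrary complex values.
\<close>

section \<open>Logarithmic derivatives and linear differential equations for power series\<close>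

text \<open>Logarithmic derivatives of factors add up. Writing f' = - f g instead of g = - f'/f
  avoids inverting series.\<close>

lemma fps_log_deriv_prod:
  fixes f g :: "'i \<Rightarrow> 'a :: comm_ring_1 fps"
  assumes "finite I" and "\<And>i. i \<in> I \<Longrightarrow> fps_deriv (f i) = - (f i * g i)"
  shows "fps_deriv (\<Prod>i\<in>I. f i) = - ((\<Prod>i\<in>I. f i) * (\<Sum>i\<in>I. g i))"
  using assms by (induction I rule: finite_induct) (simp_all add: algebra_simps)

text \<open>The equation expresses (m+1) F_(m+1) through F_0, ..., F_m, and m+1 can be cancelled.
  Coefficients range over a domain of characteristic 0 because the lemma is later applied to series
  in z over the series in y.\<close>

lemma fps_linear_ODE_unique:
  fixes F G h :: "'a :: {idom, semiring_char_0} fps"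
  assumes F: "fps_deriv F = - (F * h)" and G: "fps_deriv G = - (G * h)" and "F $ 0 = G $ 0"
  shows "F = G"
proof (rule fps_ext)
  fix n
  show "F $ n = G $ n"
  proof (induction n rule: less_induct)
    case (less n)
    show ?case
    proof (cases n)
      case (Suc m)
      have "of_nat (Suc m) * F $ Suc m = (- (F * h)) $ m"
        by (simp flip: F)
      also have "\<dots> = (- (G * h)) $ m"
        using less by (auto simp: fps_mult_nth Suc intro!: sum.cong)
      also have "\<dots> = of_nat (Suc m) * G $ Suc m"
        by (simp flip: G)
      finally show ?thesis
        unfolding Suc by (subst (asm) mult_cancel_left) (simp del: of_nat_Suc)
    qed (use assms in simp)
  qed
qed

text \<open>This is the geometric series for a / (1 - aX); multiplying by 1 - aX makes it telescope
  to the constant a.\<close>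

lemma fps_log_deriv_linear_factor:
  fixes a :: "'a :: comm_ring_1"
  shows "fps_deriv (1 - fps_const a * fps_X) =
    - ((1 - fps_const a * fps_X) * Abs_fps (\<lambda>j. a ^ Suc j))"
proof (rule fps_ext)
  fix n
  have "((1 - fps_const a * fps_X) * Abs_fps (\<lambda>j. a ^ Suc j)) $ n = (if n = 0 then a else 0)"
    by (cases n) (simp_all add: left_diff_distrib mult.assoc)
  then show "fps_deriv (1 - fps_const a * fps_X) $ n =
    (- ((1 - fps_const a * fps_X) * Abs_fps (\<lambda>j. a ^ Suc j))) $ n"
    by simp
qed

section \<open>Multisets with prescribed power sums\<close>

text \<open>The polynomial with the coefficients c in reverse order is monic of degree n, hence
  splits over the complex numbers. Reversing it back turns each factor x - a into 1 - aX.\<close>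

lemma ex_list_linear_factors:
  fixes c :: "nat \<Rightarrow> complex"
  assumes "c 0 = 1"
  obtains xs where "length xs = n"
    and "\<And>j. j \<le> n \<Longrightarrow> (\<Prod>i<n. 1 - fps_const (xs ! i) * fps_X) $ j = c j"
proof -
  define P where "P = (\<Sum>i\<le>n. monom (c i) (n - i))"
  have coeff_P: "coeff P (n - j) = c j" if "j \<le> n" for j
  proof -
    have "coeff P (n - j) = (\<Sum>i\<le>n. if i = j then c i else 0)"
      unfolding P_def coeff_sum using that by (intro sum.cong) auto
    then show ?thesis using that by simp
  qed
  have deg: "degree P = n"
  proof (rule antisym)
    show "degree P \<le> n"
      unfolding P_def by (rule degree_sum_le) (auto intro: order.trans[OF degree_monom_le])
    show "n \<le> degree P"
      using coeff_P[of 0] assms by (intro le_degree) simp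
  qed
  have "P \<noteq> 0"
    using coeff_P[of 0] assms by auto
  then obtain A where A: "size A = degree P" "P = smult (lead_coeff P) (\<Prod>x\<in>#A. [:-x, 1:])"
    using alg_closed_imp_factorization by metis
  obtain xs where xs: "A = mset xs"
    by (metis ex_mset)
  have len: "length xs = n"
    using A(1) deg xs by simp
  have P: "P = (\<Prod>i<n. [:- (xs ! i), 1:])"
    using A(2) coeff_P[of 0] assms deg len
    by (simp add: xs prod_mset_prod_list prod.list_conv_set_nth atLeast0LessThan
        del: mset_map flip: mset_map)
  have "fps_of_poly (reflect_poly [:- a, 1:]) = 1 - fps_const a * fps_X" for a :: complex
    by (simp add: reflect_poly_def fps_of_poly_pCons fps_const_neg[symmetric] mult.commute
        del: fps_const_neg)
  then have "fps_of_poly (reflect_poly P) = (\<Prod>i<n. 1 - fps_const (xs ! i) * fps_X)"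
    by (simp only: P reflect_poly_prod fps_of_poly_prod)
  moreover have "fps_of_poly (reflect_poly P) $ j = c j" if "j \<le> n" for j
    using that coeff_P[OF that] by (simp add: coeff_reflect_poly deg)
  ultimately show ?thesis
    using that[OF len] by simp
qed

lemma power_sum_mset: "power_sum j (mset xs) = (\<Sum>i<length xs. (xs ! i) ^ j)"
  by (simp add: power_sum_def sum_mset_sum_list sum.list_conv_set_nth atLeast0LessThan
      del: mset_map flip: mset_map)

(* By Newton's identities, the polynomial whose inverse roots have power sums t_1, t_2, ... is the
   truncation of exp (- sum t_j X^j / j). *)
lemma ex_multiset_power_sums:
  fixes t :: "nat \<Rightarrow> complex"
  obtains A where "size A = n" and "\<And>j. 1 \<le> j \<Longrightarrow> j \<le> n \<Longrightarrow> power_sum j A = t j"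
proof -
  \<comment> \<open>The index is shifted by one: T is the derivative of sum t_j X^j / j, so that G =
    exp (- \<integral> T).\<close>
  define T where "T = Abs_fps (\<lambda>j. t (Suc j))"
  define G where "G = fps_exp (-1) oo fps_integral0 T"
  have G0: "G $ 0 = 1"
    by (simp add: G_def)
  have G': "fps_deriv G = - (G * T)"
    by (simp add: G_def fps_compose_deriv fps_deriv_fps_integral fps_compose_mult_distrib)
      (simp flip: fps_const_neg)
  obtain xs where len: "length xs = n"
    and R: "\<And>j. j \<le> n \<Longrightarrow> (\<Prod>i<n. 1 - fps_const (xs ! i) * fps_X) $ j = G $ j"
    using ex_list_linear_factors[of "\<lambda>j. G $ j", OF G0] by metis
  define R where "R = (\<Prod>i<n. 1 - fps_const (xs ! i) * fps_X)"
  define S where "S = (\<Sum>i<n. Abs_fps (\<lambda>j. (xs ! i) ^ Suc j))"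
  have R': "fps_deriv R = - (R * S)"
    unfolding R_def S_def by (rule fps_log_deriv_prod) (simp_all only: finite_lessThan fps_log_deriv_linear_factor)
  have S_nth: "S $ j = power_sum (Suc j) (mset xs)" for j
    by (simp add: S_def power_sum_mset len fps_sum_nth)
  \<comment> \<open>Newton's identities as a recursion: R and G agree up to degree n, so R S and G T
    agree below degree n. As the constant term of G is 1, coefficient m of S is determined by the
    earlier ones.\<close>
  have "S $ m = T $ m" if "m < n" for m
    using that
  proof (induction m rule: less_induct)
    case (less m)
    have "(R * S) $ m = (G * T) $ m"
    proof -
      have "fps_deriv R $ m = fps_deriv G $ m"
        using R[of "Suc m"] less.prems by (simp add: R_def)
      then show ?thesis by (simp add: R' G')
    qed
    then have "(\<Sum>i=0..m. G $ i * S $ (m - i)) = (\<Sum>i=0..m. G $ i * T $ (m - i))"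
      using R less.prems by (simp add: fps_mult_nth R_def)
    moreover have "(\<Sum>i=Suc 0..m. G $ i * S $ (m - i)) = (\<Sum>i=Suc 0..m. G $ i * T $ (m - i))"
      using less by (intro sum.cong) auto
    ultimately show ?case
      by (simp add: sum.atLeast_Suc_atMost G0)
  qed
  then have "power_sum j (mset xs) = t j" if "1 \<le> j" "j \<le> n" for j
    using that by (cases j) (simp_all add: S_nth T_def)
  then show ?thesis
    using that[of "mset xs"] len by simp
qed

section \<open>Polynomials as functions and the uniqueness of the expressing polynomial\<close>

lemma mpoly_eval_superset:
  assumes "finite K" and "Poly_Mapping.keys P \<subseteq> K"
  shows "mpoly_eval t P = (\<Sum>m\<in>K. of_rat (Poly_Mapping.lookup P m) *
    (\<Prod>i\<in>Poly_Mapping.keys m. t i ^ Poly_Mapping.lookup m i))"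
  unfolding mpoly_eval_def using assms
  by (intro sum.mono_neutral_left) (auto simp: in_keys_iff)

lemma mpoly_eval_diff: "mpoly_eval t (P - Q) = mpoly_eval t P - mpoly_eval t Q"
proof -
  let ?K = "Poly_Mapping.keys P \<union> Poly_Mapping.keys Q"
  have "Poly_Mapping.keys (P - Q) \<subseteq> ?K"
    by (auto simp: in_keys_iff lookup_minus)
  then show ?thesis
    by (simp add: mpoly_eval_superset[of ?K] lookup_minus of_rat_diff left_diff_distrib sum_subtractf)
qed

lemma mpoly_eval_cong:
  assumes "\<And>i. i \<in> mpoly_vars P \<Longrightarrow> t i = u i"
  shows "mpoly_eval t P = mpoly_eval u P"
  unfolding mpoly_eval_def using assms
  by (intro sum.cong prod.cong arg_cong2[of _ _ _ _ "(*)"] arg_cong2[of _ _ _ _ "(^)"] refl)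
    (auto simp: mpoly_vars_def)

text \<open>Reduction modulo N recovers digit 0, and what remains is N times a shorter
  expansion.\<close>

lemma base_expansion_inj:
  fixes a b :: "nat \<Rightarrow> nat"
  assumes "\<And>i. i < K \<Longrightarrow> a i < N" and "\<And>i. i < K \<Longrightarrow> b i < N"
    and "(\<Sum>i<K. a i * N ^ i) = (\<Sum>i<K. b i * N ^ i)" and "i < K"
  shows "a i = b i"
  using assms
proof (induction K arbitrary: a b i)
  case (Suc K)
  have shift: "(\<Sum>i<Suc K. c i * N ^ i) = c 0 + N * (\<Sum>i<K. c (Suc i) * N ^ i)" for c :: "nat \<Rightarrow> nat"
    unfolding sum.lessThan_Suc_shift by (simp add: sum_distrib_left mult_ac)
  have eq: "a 0 + N * (\<Sum>i<K. a (Suc i) * N ^ i) = b 0 + N * (\<Sum>i<K. b (Suc i) * N ^ i)"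
    using Suc.prems(3) unfolding shift .
  have lt: "a 0 < N" "b 0 < N"
    using Suc.prems by auto
  have "(a 0 + N * (\<Sum>i<K. a (Suc i) * N ^ i)) mod N = (b 0 + N * (\<Sum>i<K. b (Suc i) * N ^ i)) mod N"
    by (simp only: eq)
  with lt have zero: "a 0 = b 0" by simp
  with eq lt have "(\<Sum>i<K. a (Suc i) * N ^ i) = (\<Sum>i<K. b (Suc i) * N ^ i)"
    by simp
  then have "a (Suc j) = b (Suc j)" if "j < K" for j
    using Suc.IH[of "\<lambda>i. a (Suc i)" "\<lambda>i. b (Suc i)" j] Suc.prems(1,2) that by simp
  with zero Suc.prems(4) show ?case
    by (cases i) auto
qed simp

(* Kronecker substitution: t_i = y^(N^i) with N large keeps the monomials of P apart. *)
lemma mpoly_eq_0_if_eval_0: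
  assumes "\<And>t. mpoly_eval t P = 0"
  shows "P = 0"
proof -
  let ?M = "Poly_Mapping.keys P"
  have "finite (mpoly_vars P)"
    by (simp add: mpoly_vars_def)
  then obtain K where K: "mpoly_vars P \<subseteq> {..<K}"
    using finite_nat_bounded by blast
  have "finite (\<Union>m\<in>?M. Poly_Mapping.lookup m ` {..<K})"
    by simp
  \<comment> \<open>N exceeds every exponent in P, so the exponents in m are the base-N digits of
    \<open>w m\<close>, the degree that m acquires under the substitution.\<close>
  then obtain N where N: "(\<Union>m\<in>?M. Poly_Mapping.lookup m ` {..<K}) \<subseteq> {..<N}"
    using finite_nat_bounded by blast
  define w where "w = (\<lambda>m. \<Sum>i<K. Poly_Mapping.lookup m i * N ^ i)"
  have keys: "Poly_Mapping.keys m \<subseteq> {..<K}" if "m \<in> ?M" for m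
    using K that by (auto simp: mpoly_vars_def)
  have inj: "inj_on w ?M"
  proof (rule inj_onI)
    fix m m' assume m: "m \<in> ?M" "m' \<in> ?M" and "w m = w m'"
    then have low: "Poly_Mapping.lookup m i = Poly_Mapping.lookup m' i" if "i < K" for i
      using N that unfolding w_def by (intro base_expansion_inj[where a = "Poly_Mapping.lookup m"]) auto
    show "m = m'"
    proof (rule poly_mapping_eqI)
      fix i
      show "Poly_Mapping.lookup m i = Poly_Mapping.lookup m' i"
      proof (cases "i < K")
        case False
        then have "i \<notin> Poly_Mapping.keys m" "i \<notin> Poly_Mapping.keys m'"
          using keys m by auto
        then show ?thesis by (simp add: in_keys_iff)
      qed (rule low)
    qed
  qed
  define p :: "complex poly" where "p = (\<Sum>m\<in>?M. monom (of_rat (Poly_Mapping.lookup P m)) (w m))"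
  have mono: "(\<Prod>i\<in>Poly_Mapping.keys m. (y ^ (N ^ i)) ^ Poly_Mapping.lookup m i) = y ^ w m"
    if "m \<in> ?M" for y :: complex and m
  proof -
    have "(\<Prod>i\<in>Poly_Mapping.keys m. (y ^ (N ^ i)) ^ Poly_Mapping.lookup m i) =
        (\<Prod>i<K. (y ^ (N ^ i)) ^ Poly_Mapping.lookup m i)"
      using keys[OF that] by (intro prod.mono_neutral_left) (auto simp: in_keys_iff)
    then show ?thesis
      by (simp add: w_def power_sum mult.commute flip: power_mult)
  qed
  have "poly p y = mpoly_eval (\<lambda>i. y ^ (N ^ i)) P" for y
    by (simp add: p_def poly_sum poly_monom mpoly_eval_def mono)
  then have "p = 0"
    using assms poly_all_0_iff_0 by metis
  \<comment> \<open>By injectivity of \<open>w\<close>, no two monomials of P contribute to the same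
    coefficient of p.\<close>
  have "Poly_Mapping.lookup P m = 0" if m: "m \<in> ?M" for m
  proof -
    have "coeff p (w m) = (\<Sum>m'\<in>?M. if m' = m then of_rat (Poly_Mapping.lookup P m') else 0)"
      unfolding p_def coeff_sum using m by (intro sum.cong) (auto dest: inj_onD[OF inj])
    then show ?thesis
      using m \<open>p = 0\<close> by simp
  qed
  then show ?thesis
    by (metis in_keys_iff lookup_zero poly_mapping_eqI)
qed

text \<open>Two such polynomials agree on all tuples of power sums. Since k \<le> n, the values of
  t_1, ..., t_k are arbitrary on such tuples, so the difference vanishes everywhere.\<close>

lemma expresses_subset_power_sum_unique:
  assumes P: "expresses_subset_power_sum s k n P" and Q: "expresses_subset_power_sum s k n Q"
    and "k \<le> n"
  shows "P = Q"
proof -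
  have "mpoly_eval t (P - Q) = 0" for t
  proof -
    obtain A where A: "size A = n" "\<And>j. 1 \<le> j \<Longrightarrow> j \<le> n \<Longrightarrow> power_sum j A = t j"
      using ex_multiset_power_sums by metis
    have "mpoly_eval t R = power_sum k (subset_sums s A)"
      if R: "expresses_subset_power_sum s k n R" for R
    proof -
      have "mpoly_eval t R = mpoly_eval (\<lambda>j. power_sum j A) R"
        using R A(2) \<open>k \<le> n\<close> unfolding expresses_subset_power_sum_def
        by (intro mpoly_eval_cong) fastforce
      then show ?thesis
        using R A(1) unfolding expresses_subset_power_sum_def by simp
    qed
    with P Q show ?thesis
      by (simp add: mpoly_eval_diff)
  qed
  then have "P - Q = 0"
    by (rule mpoly_eq_0_if_eval_0)
  then show ?thesis by simp
qed

section \<open>The generating function of the power sums of subset sums\<close>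

text \<open>This is (y d/dy)^j applied to y / (1 - y). The case m = 0 is excluded explicitly because
  0^0 = 1 would give a constant term when j = 0.\<close>

definition fps_moment :: "nat \<Rightarrow> complex fps" where
  "fps_moment j = Abs_fps (\<lambda>m. if m = 0 then 0 else of_nat m ^ j)"

lemma fps_moment_nth_0 [simp]: "fps_moment j $ 0 = 0"
  by (simp add: fps_moment_def)

text \<open>Put m = r + 1 and expand (r + 1)^k by the binomial theorem. The summand 1 supplies the
  coefficient of y, since the moment series have no constant term.\<close>

lemma fps_moment_rec:
  "fps_moment k = fps_X * (1 + (\<Sum>i=0..k. of_nat (k choose i) * fps_moment (k - i)))"
proof (rule fps_ext)
  fix m
  show "fps_moment k $ m = (fps_X * (1 + (\<Sum>i=0..k. of_nat (k choose i) * fps_moment (k - i)))) $ m"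
  proof (cases m)
    case (Suc r)
    have "(\<Sum>i=0..k. of_nat (k choose i) * fps_moment (k - i)) $ r =
        (\<Sum>i=0..k. of_nat (k choose i) * (fps_moment (k - i) $ r))"
      by (simp add: fps_sum_nth flip: fps_of_nat)
    also have "\<dots> = (if r = 0 then 0 else of_nat (Suc r) ^ k)"
      using binomial_ring[of "1 :: complex" "of_nat r" k]
      by (simp add: fps_moment_def atMost_atLeast0)
    finally show ?thesis
      using Suc by (simp add: fps_moment_def)
  qed simp
qed

(* In power series in z whose coefficients are power series in y, fps_const fps_X is y
   and fps_exp_const a is e^(a z). *)
definition fps_exp_const :: "complex \<Rightarrow> complex fps fps" where
  "fps_exp_const a = Abs_fps (\<lambda>k. fps_const (a ^ k / fact k))"

lemma fps_exp_const_0: "fps_exp_const 0 = 1"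
  by (rule fps_ext) (simp add: fps_exp_const_def power_0_left)

lemma fps_const_sum: "fps_const (\<Sum>i\<in>I. f i) = (\<Sum>i\<in>I. fps_const (f i))"
  by (rule fps_ext) (simp add: fps_sum_nth)

lemma fps_exp_const_add: "fps_exp_const (a + b) = fps_exp_const a * fps_exp_const b"
proof (rule fps_ext)
  fix k
  have "(fps_exp a * fps_exp b) $ k = fps_exp (a + b) $ k"
    by (simp add: fps_exp_add_mult)
  then have "(\<Sum>i=0..k. a ^ i / fact i * (b ^ (k - i) / fact (k - i))) = (a + b) ^ k / fact k"
    by (simp add: fps_mult_nth)
  then show "fps_exp_const (a + b) $ k = (fps_exp_const a * fps_exp_const b) $ k"
    by (simp add: fps_exp_const_def fps_mult_nth flip: fps_const_sum)
qed

lemma fps_exp_const_sum: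
  "finite I \<Longrightarrow> fps_exp_const (\<Sum>i\<in>I. f i) = (\<Prod>i\<in>I. fps_exp_const (f i))"
  by (induction I rule: finite_induct) (simp_all add: fps_exp_const_0 fps_exp_const_add)

text \<open>Formally, a y e^(az) / (1 - y e^(az)) is the sum of a y^m e^(amz) over m \<ge> 1, and
  its coefficient of z^j is a^(j+1) / j! times the moment series of order j. The check multiplies
  out: 1 / (i! (k-i)!) yields binomials, and \<open>fps_moment_rec\<close> collapses the sum to a
  single y.\<close>

lemma fps_log_deriv_exp_factor:
  "fps_deriv (1 - fps_const fps_X * fps_exp_const a) =
    - ((1 - fps_const fps_X * fps_exp_const a) *
       Abs_fps (\<lambda>j. fps_const (a ^ Suc j / fact j) * fps_moment j))"
proof (rule fps_ext)
  fix k
  let ?g = "Abs_fps (\<lambda>j. fps_const (a ^ Suc j / fact j) * fps_moment j)"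
  have coeff: "fps_const (a ^ i / fact i) * (fps_const (a ^ Suc (k - i) / fact (k - i)) * fps_moment (k - i)) =
      fps_const (a ^ Suc k / fact k) * (of_nat (k choose i) * fps_moment (k - i))"
    if "i \<le> k" for i
  proof -
    have "a ^ i / fact i * (a ^ Suc (k - i) / fact (k - i)) =
        a ^ Suc k / fact k * of_nat (k choose i)"
      using that by (simp add: binomial_fact field_simps flip: power_add)
    then show ?thesis
      by (simp flip: mult.assoc fps_of_nat)
  qed
  have "(fps_exp_const a * ?g) $ k =
      fps_const (a ^ Suc k / fact k) * (\<Sum>i=0..k. of_nat (k choose i) * fps_moment (k - i))"
    unfolding sum_distrib_left fps_mult_nth fps_exp_const_def fps_nth_Abs_fps
    using coeff by (intro sum.cong) auto
  then have "((1 - fps_const fps_X * fps_exp_const a) * ?g) $ k =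
      fps_const (a ^ Suc k / fact k) *
        (fps_moment k - fps_X * (\<Sum>i=0..k. of_nat (k choose i) * fps_moment (k - i)))"
    by (simp add: left_diff_distrib mult.assoc right_diff_distrib mult.left_commute)
  also have "\<dots> = fps_const (a ^ Suc k / fact k) * fps_X"
    by (subst (1) fps_moment_rec) (simp add: algebra_simps)
  finally have rhs: "((1 - fps_const fps_X * fps_exp_const a) * ?g) $ k =
      fps_const (a ^ Suc k / fact k) * fps_X" .
  have "of_nat (Suc k) * fps_const (a ^ Suc k / fact (Suc k)) = fps_const (a ^ Suc k / fact k)"
    by (simp add: fact_Suc del: of_nat_Suc flip: fps_of_nat)
  then have "fps_deriv (1 - fps_const fps_X * fps_exp_const a) $ k =
      - (fps_const (a ^ Suc k / fact k) * fps_X)"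
    by (simp add: fps_exp_const_def mult.left_commute mult.commute del: of_nat_Suc fact_Suc power_Suc)
  then show "fps_deriv (1 - fps_const fps_X * fps_exp_const a) $ k =
      (- ((1 - fps_const fps_X * fps_exp_const a) * ?g)) $ k"
    using rhs by simp
qed

text \<open>Expanding the product over index sets I, each I contributes (-y)^|I| e^(bz), where b is
  the sum of the entries selected by I. The outer index \<open>k\<close> refers to z, the inner
  \<open>s\<close> to y.\<close>

lemma prod_exp_factors_nth:
  "(\<Prod>i<length xs. 1 - fps_const fps_X * fps_exp_const (xs ! i)) $ k $ s =
    (-1) ^ s / fact k * power_sum k (list_subset_sums s xs)"
proof -
  let ?n = "length xs"
  have sign: "fps_const (fps_const (-1 :: complex)) = -1"
    by (simp flip: fps_const_neg)
  have "(\<Prod>i<?n. 1 - fps_const fps_X * fps_exp_const (xs ! i)) =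
      (\<Prod>i<?n. - (fps_const fps_X * fps_exp_const (xs ! i)) + 1)"
    by simp
  also have "\<dots> = (\<Sum>I\<in>Pow {..<?n}. \<Prod>i\<in>I. - (fps_const fps_X * fps_exp_const (xs ! i)))"
    by (subst prod_add) simp_all
  also have "\<dots> = (\<Sum>I\<in>Pow {..<?n}. fps_const (fps_const ((-1) ^ card I) * fps_X ^ card I) * fps_exp_const (\<Sum>i\<in>I. xs ! i))"
  proof (intro sum.cong refl)
    fix I assume "I \<in> Pow {..<?n}"
    then have "finite I" by (auto intro: finite_subset)
    then show "(\<Prod>i\<in>I. - (fps_const fps_X * fps_exp_const (xs ! i))) =
        fps_const (fps_const ((-1) ^ card I) * fps_X ^ card I) * fps_exp_const (\<Sum>i\<in>I. xs ! i)"
      by (simp add: prod_uminus prod.distrib fps_exp_const_sum mult.assoc sign flip: fps_const_power fps_const_mult)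
  qed
  also have "\<dots> $ k $ s = (\<Sum>I\<in>Pow {..<?n}. if card I = s then (-1) ^ s * ((\<Sum>i\<in>I. xs ! i) ^ k / fact k) else 0)"
    unfolding fps_sum_nth
  proof (intro sum.cong refl)
    fix I
    have "(fps_const (fps_const ((-1) ^ card I) * fps_X ^ card I) * fps_exp_const (\<Sum>i\<in>I. xs ! i)) $ k =
        fps_const ((-1) ^ card I * ((\<Sum>i\<in>I. xs ! i) ^ k / fact k)) * fps_X ^ card I"
      by (simp add: fps_exp_const_def mult.commute mult.left_commute flip: fps_const_mult)
    then show "(fps_const (fps_const ((-1) ^ card I) * fps_X ^ card I) * fps_exp_const (\<Sum>i\<in>I. xs ! i)) $ k $ s =
        (if card I = s then (-1) ^ s * ((\<Sum>i\<in>I. xs ! i) ^ k / fact k) else 0)"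
      by (simp only: fps_mult_left_const_nth fps_X_power_nth) auto
  qed
  also have "\<dots> = (\<Sum>I | I \<subseteq> {..<?n} \<and> card I = s. (-1) ^ s * ((\<Sum>i\<in>I. xs ! i) ^ k / fact k))"
  proof -
    have "{I. I \<subseteq> {..<?n} \<and> card I = s} = {I \<in> Pow {..<?n}. card I = s}"
      by auto
    then show ?thesis
      by (simp only: sum.inter_filter finite_Pow_iff finite_lessThan)
  qed
  also have "\<dots> = (-1) ^ s / fact k * power_sum k (list_subset_sums s xs)"
  proof -
    have "power_sum k (list_subset_sums s xs) = (\<Sum>I | I \<subseteq> {..<?n} \<and> card I = s. (\<Sum>i\<in>I. xs ! i) ^ k)"
      unfolding power_sum_def list_subset_sums_def image_mset.compositionality comp_def
      by (rule sum_unfold_sum_mset[symmetric])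
    then show ?thesis
      by (simp add: sum_distrib_left)
  qed
  finally show ?thesis .
qed

section \<open>Expansion over compositions and partitions\<close>

text \<open>In the Cauchy product, an index tuple with a zero entry picks a vanishing constant term,
  so only tuples of positive integers survive.\<close>

lemma prod_list_fps_nth:
  fixes fs :: "'a :: comm_ring_1 fps list"
  assumes "\<And>f. f \<in> set fs \<Longrightarrow> f $ 0 = 0"
  shows "prod_list fs $ n = (\<Sum>v\<in>compositions (length fs) n. \<Prod>i<length fs. (fs ! i) $ (v ! i))"
proof (cases "length fs")
  \<comment> \<open>The product formula used below has index set 0..d, which is never empty.\<close>
  case 0
  have "compositions 0 n = (if n = 0 then {[]} else {})"
    by (auto simp: compositions_def)
  with 0 show ?thesis
    by simp
next
  case (Suc d)
  have "prod_list fs $ n = (\<Prod>i=0..d. fs ! i) $ n"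
    using Suc by (simp add: prod.list_conv_set_nth atLeastLessThanSuc_atLeastAtMost)
  also have "\<dots> = (\<Sum>v\<in>natpermute n (length fs). \<Prod>i<length fs. (fs ! i) $ (v ! i))"
    unfolding fps_prod_nth using Suc by (simp add: atLeast0AtMost lessThan_Suc_atMost)
  also have "\<dots> = (\<Sum>v\<in>compositions (length fs) n. \<Prod>i<length fs. (fs ! i) $ (v ! i))"
  proof (rule sum.mono_neutral_right[OF natpermute_finite])
    show "compositions (length fs) n \<subseteq> natpermute n (length fs)"
      by (auto simp: compositions_def natpermute_def)
    show "\<forall>v\<in>natpermute n (length fs) - compositions (length fs) n.
        (\<Prod>i<length fs. (fs ! i) $ (v ! i)) = 0"
    proof
      fix v assume "v \<in> natpermute n (length fs) - compositions (length fs) n"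
      then have v: "length v = length fs" "\<exists>x\<in>set v. x = 0"
        by (auto simp: compositions_def natpermute_def not_le)
      then obtain i where "i < length fs" "v ! i = 0"
        by (metis in_set_conv_nth)
      then show "(\<Prod>i<length fs. (fs ! i) $ (v ! i)) = 0"
        using assms by (intro prod_zero) force+
    qed
  qed
  finally show ?thesis .
qed

lemma partition_eq_if_mset_eq:
  assumes "l \<in> partitions k" and "l' \<in> partitions k" and "mset l = mset l'"
  shows "l = l'"
proof -
  have "sorted (rev l)" "sorted (rev l')" "mset (rev l) = mset (rev l')"
    using assms by (simp_all add: partitions_def sorted_wrt_rev)
  then have "rev l = rev l'"
    by (metis properties_for_sort)
  then show ?thesis by simp
qed

text \<open>Sorting maps each composition to exactly one partition, and the fibre over a partition
  consists of its rearrangements. Parts are positive, so d \<le> k captures all compositions of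
  k.\<close>

lemma sum_compositions_eq_sum_partitions:
  fixes f :: "nat multiset \<Rightarrow> 'a :: comm_semiring_1"
  shows "(\<Sum>d=0..k. \<Sum>v\<in>compositions d k. f (mset v)) =
    (\<Sum>l\<in>partitions k. of_nat (card (permutations_of_multiset (mset l))) * f (mset l))"
proof -
  have len: "length v \<le> sum_list v" if "\<forall>x\<in>set v. 1 \<le> x" for v :: "nat list"
    using that by (induction v) auto
  have "(\<Union>d\<in>{0..k}. compositions d k) = (\<Union>l\<in>partitions k. permutations_of_multiset (mset l))"
  proof (intro equalityI subsetI)
    fix v assume "v \<in> (\<Union>d\<in>{0..k}. compositions d k)"
    then have "\<forall>x\<in>set v. 1 \<le> x" "sum_list v = k"
      by (auto simp: compositions_def)
    then have "rev (sort v) \<in> partitions k"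
      by (auto simp: partitions_def sorted_wrt_rev simp flip: sum_mset_sum_list)
    then show "v \<in> (\<Union>l\<in>partitions k. permutations_of_multiset (mset l))"
      by (intro UN_I[of "rev (sort v)"]) (auto simp: permutations_of_multiset_def)
  next
    fix v assume "v \<in> (\<Union>l\<in>partitions k. permutations_of_multiset (mset l))"
    then obtain l where l: "l \<in> partitions k" "mset v = mset l"
      by (auto simp: permutations_of_multiset_def)
    then have "set v = set l" "sum_list v = sum_list l"
      by (metis mset_eq_setD, metis sum_mset_sum_list)
    then have "\<forall>x\<in>set v. 1 \<le> x" "sum_list v = k"
      using l by (auto simp: partitions_def)
    then show "v \<in> (\<Union>d\<in>{0..k}. compositions d k)"
      using len by (auto simp: compositions_def)
  qed
  moreover have "(\<Sum>d=0..k. \<Sum>v\<in>compositions d k. f (mset v)) =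
      (\<Sum>v\<in>(\<Union>d\<in>{0..k}. compositions d k). f (mset v))"
    by (rule sum.UNION_disjoint[symmetric]) (simp_all add: finite_compositions, auto simp: compositions_def)
  moreover have "(\<Sum>v\<in>(\<Union>l\<in>partitions k. permutations_of_multiset (mset l)). f (mset v)) =
      (\<Sum>l\<in>partitions k. \<Sum>v\<in>permutations_of_multiset (mset l). f (mset v))"
  proof (rule sum.UNION_disjoint)
    show "\<forall>l\<in>partitions k. \<forall>l'\<in>partitions k. l \<noteq> l' \<longrightarrow>
        permutations_of_multiset (mset l) \<inter> permutations_of_multiset (mset l') = {}"
      using partition_eq_if_mset_eq by (auto simp: permutations_of_multiset_def)
  qed (simp_all add: finite_partitions)
  moreover have "(\<Sum>v\<in>permutations_of_multiset (mset l). f (mset v)) =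
      of_nat (card (permutations_of_multiset (mset l))) * f (mset l)" for l
    by (simp add: permutations_of_multiset_def)
  ultimately show ?thesis by simp
qed

lemma one_minus_fps_X_power_nth:
  "((1 - fps_X) ^ n :: 'a :: comm_ring_1 fps) $ p = (-1) ^ p * of_nat (n choose p)"
proof -
  have "((1 - fps_X) ^ n :: 'a fps) = (\<Sum>i\<le>n. of_nat (n choose i) * (- fps_X) ^ i)"
    using binomial_ring[of "- fps_X" "1 :: 'a fps" n] by simp
  also have "\<dots> = (\<Sum>i\<le>n. fps_const ((-1) ^ i * of_nat (n choose i)) * fps_X ^ i)"
    by (intro sum.cong refl)
      (simp add: power_minus[of fps_X] fps_of_nat mult_ac flip: fps_const_mult fps_const_power fps_const_neg)
  also have "\<dots> $ p = (\<Sum>i\<le>n. if i = p then (-1) ^ p * of_nat (n choose p) else 0)"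
    unfolding fps_sum_nth by (intro sum.cong refl) (auto simp: fps_X_power_nth)
  also have "\<dots> = (-1) ^ p * of_nat (n choose p)"
    by (simp add: binomial_eq_0)
  finally show ?thesis .
qed

lemma fps_power_nth_compositions:
  fixes B :: "'a :: comm_ring_1 fps"
  assumes "B $ 0 = 0"
  shows "B ^ d $ k = (\<Sum>v\<in>compositions d k. \<Prod>j\<in>#mset v. B $ j)"
proof -
  have "B ^ d $ k = (\<Sum>v\<in>compositions d k. \<Prod>i<d. replicate d B ! i $ (v ! i))"
    using prod_list_fps_nth[of "replicate d B" k] assms by simp
  also have "\<dots> = (\<Sum>v\<in>compositions d k. \<Prod>j\<in>#mset v. B $ j)"
    by (intro sum.cong refl)
      (auto simp: compositions_def prod_mset_prod_list prod.list_conv_set_nth atLeast0LessThan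
        simp del: mset_map simp flip: mset_map)
  finally show ?thesis .
qed

text \<open>Both sides solve F' = - F B': on the left B' is the sum of the contributions of the
  factors, on the right the chain rule applies to exp (-B). At z = 0 both equal (1 - y)^n. Setting
  the constant term of B to 0 makes the composition legitimate and keeps \<open>j - 1\<close> from
  truncating.\<close>

lemma prod_exp_factors_eq_compose:
  fixes xs :: "complex list"
  defines "B \<equiv> Abs_fps (\<lambda>j. if j = 0 then 0
    else fps_const (power_sum j (mset xs) / fact j) * fps_moment (j - 1))"
  shows "(\<Prod>i<length xs. 1 - fps_const fps_X * fps_exp_const (xs ! i)) =
    fps_const ((1 - fps_X) ^ length xs) * (Abs_fps (\<lambda>d. fps_const ((-1) ^ d / fact d)) oo B)"
proof (rule fps_linear_ODE_unique)
  let ?F = "\<Prod>i<length xs. 1 - fps_const fps_X * fps_exp_const (xs ! i)"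
  let ?e = "Abs_fps (\<lambda>d. fps_const ((-1) ^ d / fact d :: complex))"
  let ?g = "\<lambda>i. Abs_fps (\<lambda>j. fps_const ((xs ! i) ^ Suc j / fact j) * fps_moment j)"
  have B0: "B $ 0 = 0"
    by (simp add: B_def)
  have "fps_deriv B = (\<Sum>i<length xs. ?g i)"
  proof (rule fps_ext)
    fix j
    have "of_nat (Suc j) * fps_const (power_sum (Suc j) (mset xs) / fact (Suc j)) =
        fps_const (power_sum (Suc j) (mset xs) / fact j)"
      by (simp add: fact_Suc del: of_nat_Suc flip: fps_of_nat)
    also have "\<dots> = (\<Sum>i<length xs. fps_const ((xs ! i) ^ Suc j / fact j))"
      by (simp add: power_sum_mset sum_divide_distrib fps_const_sum)
    finally show "fps_deriv B $ j = (\<Sum>i<length xs. ?g i) $ j"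
      by (simp add: B_def fps_sum_nth sum_distrib_right del: of_nat_Suc fact_Suc power_Suc flip: mult.assoc)
  qed
  then show "fps_deriv ?F = - (?F * fps_deriv B)"
    by (simp only:) (intro fps_log_deriv_prod finite_lessThan fps_log_deriv_exp_factor)
  \<comment> \<open>\<open>?e\<close> is e^(-z) with its coefficients viewed as constants in
    y.\<close>
  have e': "fps_deriv ?e = - ?e"
  proof (rule fps_ext)
    fix d
    have "of_nat (Suc d) * ((-1) ^ Suc d / fact (Suc d)) = - ((-1) ^ d / fact d :: complex)"
      by (simp add: fact_Suc del: of_nat_Suc)
    then have "of_nat (Suc d) * fps_const ((-1) ^ Suc d / fact (Suc d)) = fps_const (- ((-1) ^ d / fact d :: complex))"
      by (simp only: fps_const_mult flip: fps_of_nat)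
    then show "fps_deriv ?e $ d = (- ?e) $ d"
      by (simp del: of_nat_Suc fact_Suc power_Suc)
  qed
  show "fps_deriv (fps_const ((1 - fps_X) ^ length xs) * (?e oo B)) =
      - (fps_const ((1 - fps_X) ^ length xs) * (?e oo B) * fps_deriv B)"
    by (simp add: fps_compose_deriv[OF B0] e' fps_compose_uminus mult.assoc)
  have "(\<Prod>i\<in>I. 1 - fps_const fps_X * fps_exp_const (xs ! i)) $ 0 = (1 - fps_X) ^ card I"
    if "finite I" for I
    using that by (induction I rule: finite_induct) (simp_all add: fps_exp_const_def)
  then show "?F $ 0 = (fps_const ((1 - fps_X) ^ length xs) * (?e oo B)) $ 0"
    by simp
qed

text \<open>In exp (-B) a composition with d parts has weight (-1)^d / d!. A partition with
  multiplicities \<delta>_i has d! / (\<delta>_1! ... \<delta>_q!) rearrangements, so d! cancels and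
  the factorials of the multiplicities remain.\<close>

lemma prod_exp_factors_nth_partitions:
  "(\<Prod>i<length xs. 1 - fps_const fps_X * fps_exp_const (xs ! i)) $ k =
    (1 - fps_X) ^ length xs * (\<Sum>l\<in>partitions k.
      fps_const ((-1) ^ length l / (\<Prod>v\<in>set l. fact (count_list l v))) *
      (\<Prod>j\<leftarrow>l. fps_const (power_sum j (mset xs) / fact j) * fps_moment (j - 1)))"
proof -
  define B where "B = Abs_fps (\<lambda>j. if j = 0 then 0
    else fps_const (power_sum j (mset xs) / fact j) * fps_moment (j - 1))"
  define f where "f = (\<lambda>M. fps_const ((-1) ^ size M / fact (size M)) * (\<Prod>j\<in>#M. B $ j))"
  have B0: "B $ 0 = 0"
    by (simp add: B_def)
  have "(Abs_fps (\<lambda>d. fps_const ((-1) ^ d / fact d)) oo B) $ k =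
      (\<Sum>d=0..k. \<Sum>v\<in>compositions d k. f (mset v))"
    unfolding fps_compose_nth fps_power_nth_compositions[OF B0] sum_distrib_left fps_nth_Abs_fps f_def
    by (intro sum.cong refl) (simp add: compositions_def)
  also have "\<dots> = (\<Sum>l\<in>partitions k. of_nat (card (permutations_of_multiset (mset l))) * f (mset l))"
    by (rule sum_compositions_eq_sum_partitions)
  also have "\<dots> = (\<Sum>l\<in>partitions k.
      fps_const ((-1) ^ length l / (\<Prod>v\<in>set l. fact (count_list l v))) *
      (\<Prod>j\<leftarrow>l. fps_const (power_sum j (mset xs) / fact j) * fps_moment (j - 1)))"
  proof (intro sum.cong refl)
    fix l assume l: "l \<in> partitions k"
    let ?c = "card (permutations_of_multiset (mset l))"
    have "?c * (\<Prod>v\<in>set l. fact (count_list l v)) = fact (length l)"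
      using card_permutations_of_multiset_aux[of "mset l"] by (simp add: count_mset)
    then have "of_nat (?c * (\<Prod>v\<in>set l. fact (count_list l v))) = (of_nat (fact (length l)) :: complex)"
      by (simp only:)
    then have "of_nat ?c * (\<Prod>v\<in>set l. fact (count_list l v)) = (fact (length l) :: complex)"
      by simp
    then have "of_nat ?c * ((-1) ^ length l / fact (length l)) =
        ((-1) ^ length l / (\<Prod>v\<in>set l. fact (count_list l v)) :: complex)"
      by (simp add: field_simps)
    then have "of_nat ?c * fps_const ((-1) ^ length l / fact (length l)) =
        fps_const ((-1) ^ length l / (\<Prod>v\<in>set l. fact (count_list l v)) :: complex)"
      by (simp only: fps_const_mult flip: fps_of_nat)
    moreover have "(\<Prod>j\<in>#mset l. B $ j) =
        (\<Prod>j\<leftarrow>l. fps_const (power_sum j (mset xs) / fact j) * fps_moment (j - 1))"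
    proof -
      have "map (($) B) l = map (\<lambda>j. fps_const (power_sum j (mset xs) / fact j) * fps_moment (j - 1)) l"
        using l by (intro map_cong refl) (auto simp: partitions_def B_def)
      then show ?thesis
        by (metis mset_map prod_mset_prod_list)
    qed
    ultimately show "of_nat ?c * f (mset l) =
        fps_const ((-1) ^ length l / (\<Prod>v\<in>set l. fact (count_list l v))) *
        (\<Prod>j\<leftarrow>l. fps_const (power_sum j (mset xs) / fact j) * fps_moment (j - 1))"
      by (simp only: f_def size_mset flip: mult.assoc)
  qed
  finally show ?thesis
    unfolding prod_exp_factors_eq_compose B_def by simp
qed

lemma prod_list_moments_nth:
  "(\<Prod>j\<leftarrow>l. fps_const (a j) * fps_moment (j - 1)) $ r =
    (\<Prod>j\<leftarrow>l. a j) * (\<Sum>m\<in>compositions (length l) r. \<Prod>i<length l. of_nat (m ! i) ^ (l ! i - 1))"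
proof -
  have "(\<Prod>j\<leftarrow>l. fps_const (a j) * fps_moment (j - 1)) =
      fps_const (\<Prod>j\<leftarrow>l. a j) * prod_list (map (\<lambda>j. fps_moment (j - 1)) l)"
    by (induction l) (simp_all add: mult_ac flip: fps_const_mult)
  moreover have "prod_list (map (\<lambda>j. fps_moment (j - 1)) l) $ r =
      (\<Sum>m\<in>compositions (length l) r. \<Prod>i<length l. of_nat (m ! i) ^ (l ! i - 1))"
  proof (subst prod_list_fps_nth)
    show "(\<Sum>v\<in>compositions (length (map (\<lambda>j. fps_moment (j - 1)) l)) r.
        \<Prod>i<length (map (\<lambda>j. fps_moment (j - 1)) l). map (\<lambda>j. fps_moment (j - 1)) l ! i $ (v ! i)) =
      (\<Sum>m\<in>compositions (length l) r. \<Prod>i<length l. of_nat (m ! i) ^ (l ! i - 1))"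
      unfolding length_map
    proof (intro sum.cong prod.cong refl)
      fix m i assume "m \<in> compositions (length l) r" "i \<in> {..<length l}"
      then have "i < length l" "m ! i \<noteq> 0"
        by (auto simp: compositions_def all_set_conv_all_nth)
      then show "map (\<lambda>j. fps_moment (j - 1)) l ! i $ (m ! i) = of_nat (m ! i) ^ (l ! i - 1)"
        by (simp add: fps_moment_def)
    qed
  qed auto
  ultimately show ?thesis by simp
qed

section \<open>The closed formula and the coefficients of the polynomial\<close>

text \<open>The claimed value of c_\<lambda>, kept apart from \<open>Q_coeff\<close> until
  uniqueness identifies the two.\<close>

definition partition_coeff :: "nat \<Rightarrow> nat \<Rightarrow> nat \<Rightarrow> nat list \<Rightarrow> rat" where
  "partition_coeff s k n l =
     (-1) ^ (s + length l) * fact k /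
       ((\<Prod>i<length l. fact (l ! i)) * (\<Prod>v\<in>set l. fact (count_list l v))) *
     (\<Sum>p=0..s. \<Sum>m\<in>compositions (length l) (s - p).
        (-1) ^ p * of_nat (n choose p) * (\<Prod>i<length l. of_nat (m ! i) ^ (l ! i - 1)))"

lemma of_rat_fact: "of_rat (fact n) = (fact n :: 'a :: field_char_0)"
  by (metis of_nat_fact of_rat_of_nat_eq)

text \<open>Compare the coefficients of y^s z^k in the two forms of the product: y^p comes from (1 -
  y)^n, y^(s-p) from the moment series, and the factorials of the parts from p_j / j!.\<close>

lemma power_sum_subset_sums:
  "power_sum k (subset_sums s A) =
    (\<Sum>l\<in>partitions k. of_rat (partition_coeff s k (size A) l) * (\<Prod>j\<leftarrow>l. power_sum j A))"
proof -
  obtain xs where A: "A = mset xs"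
    by (metis ex_mset)
  let ?n = "length xs"
  let ?W = "\<lambda>l r. \<Sum>m\<in>compositions (length l) r. \<Prod>i<length l. of_nat (m ! i) ^ (l ! i - 1) :: complex"
  have div: "(\<Prod>j\<leftarrow>l. power_sum j A / fact j) = (\<Prod>j\<leftarrow>l. power_sum j A) / (\<Prod>i<length l. fact (l ! i))" for l
    by (simp add: prod.list_conv_set_nth atLeast0LessThan prod_dividef)
  have "(-1) ^ s / fact k * power_sum k (subset_sums s A) =
      ((1 - fps_X) ^ ?n * (\<Sum>l\<in>partitions k.
      fps_const ((-1) ^ length l / (\<Prod>v\<in>set l. fact (count_list l v))) *
      (\<Prod>j\<leftarrow>l. fps_const (power_sum j A / fact j) * fps_moment (j - 1)))) $ s"
    unfolding A subset_sums_mset prod_exp_factors_nth[symmetric] prod_exp_factors_nth_partitions ..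
  also have "\<dots> = (\<Sum>p=0..s. (-1) ^ p * of_nat (?n choose p) * (\<Sum>l\<in>partitions k.
      (-1) ^ length l / (\<Prod>v\<in>set l. fact (count_list l v)) *
      ((\<Prod>j\<leftarrow>l. power_sum j A / fact j) * ?W l (s - p))))"
    by (simp only: fps_mult_nth[of "(1 - fps_X) ^ ?n"] one_minus_fps_X_power_nth fps_sum_nth
        fps_mult_left_const_nth prod_list_moments_nth)
  also have "\<dots> = (\<Sum>l\<in>partitions k. \<Sum>p=0..s.
      (-1) ^ length l / ((\<Prod>i<length l. fact (l ! i)) * (\<Prod>v\<in>set l. fact (count_list l v))) *
      (\<Prod>j\<leftarrow>l. power_sum j A) * ((-1) ^ p * of_nat (?n choose p) * ?W l (s - p)))"
    unfolding sum_distrib_left[of _ _ "partitions k"] div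
    by (subst sum.swap) (simp add: mult_ac)
  also have "\<dots> = (\<Sum>l\<in>partitions k.
      (-1) ^ length l / ((\<Prod>i<length l. fact (l ! i)) * (\<Prod>v\<in>set l. fact (count_list l v))) *
      (\<Prod>j\<leftarrow>l. power_sum j A) * (\<Sum>p=0..s. (-1) ^ p * of_nat (?n choose p) * ?W l (s - p)))"
    by (simp only: sum_distrib_left)
  finally have eq: "(-1) ^ s / fact k * power_sum k (subset_sums s A) = \<dots>" .
  \<comment> \<open>Multiplying by (-1)^s k! undoes the normalisation, as (-1)^(2s) = 1.\<close>
  have "power_sum k (subset_sums s A) =
      (-1) ^ s * fact k * ((-1) ^ s / fact k * power_sum k (subset_sums s A))"
    by (simp flip: power_add mult_2)
  also have "\<dots> = (\<Sum>l\<in>partitions k. of_rat (partition_coeff s k (size A) l) * (\<Prod>j\<leftarrow>l. power_sum j A))"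
    unfolding eq sum_distrib_left[of _ _ "partitions k"]
  proof (intro sum.cong refl)
    fix l
    have "of_rat (partition_coeff s k (size A) l) =
        (-1) ^ s * fact k * ((-1) ^ length l / ((\<Prod>i<length l. fact (l ! i)) * (\<Prod>v\<in>set l. fact (count_list l v)))) *
        (\<Sum>p=0..s. (-1) ^ p * of_nat (?n choose p) * ?W l (s - p))"
      by (simp add: partition_coeff_def A of_rat_mult of_rat_divide of_rat_sum of_rat_prod of_rat_power
          of_rat_fact power_add sum_distrib_left mult_ac)
    then show "(-1) ^ s * fact k * ((-1) ^ length l / ((\<Prod>i<length l. fact (l ! i)) *
        (\<Prod>v\<in>set l. fact (count_list l v))) * (\<Prod>j\<leftarrow>l. power_sum j A) *
        (\<Sum>p=0..s. (-1) ^ p * of_nat (?n choose p) * ?W l (s - p))) =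
      of_rat (partition_coeff s k (size A) l) * (\<Prod>j\<leftarrow>l. power_sum j A)"
      by (simp only: mult_ac)
  qed
  finally show ?thesis .
qed

lemma lookup_partition_exponent: "Poly_Mapping.lookup (partition_exponent l) i = count_list l i"
  unfolding partition_exponent_def by (induction l) (simp_all add: lookup_add lookup_single when_def)

lemma keys_partition_exponent: "Poly_Mapping.keys (partition_exponent l) = set l"
  by (auto simp: in_keys_iff lookup_partition_exponent count_list_0_iff)

lemma inj_on_partition_exponent: "inj_on partition_exponent (partitions k)"
proof (rule inj_onI)
  fix l l' assume l: "l \<in> partitions k" "l' \<in> partitions k" "partition_exponent l = partition_exponent l'"
  then have "mset l = mset l'"
    by (metis count_mset lookup_partition_exponent multiset_eqI)
  then show "l = l'"
    using l by (metis (no_types, lifting) partition_eq_if_mset_eq)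
qed

theorem theorem2p1:
  fixes s k n :: nat
  assumes "s \<le> n" and "k \<le> n"
  shows "(\<exists>!P. expresses_subset_power_sum s k n P) \<and>
    Q_poly s k n =
      (\<Sum>l\<in>partitions k. Poly_Mapping.single (partition_exponent l) (Q_coeff s k n l)) \<and>
    (\<forall>l\<in>partitions k.
       Q_coeff s k n l =
         (-1) ^ (s + length l) * fact k /
           ((\<Prod>i<length l. fact (l ! i)) * (\<Prod>v\<in>set l. fact (count_list l v))) *
         (\<Sum>p=0..s. \<Sum>m\<in>compositions (length l) (s - p).
            (-1) ^ p * of_nat (n choose p) * (\<Prod>i<length l. of_nat (m ! i) ^ (l ! i - 1))))"
proof -
  \<comment> \<open>The candidate with the claimed coefficients; once it is shown to express the
    power sum, uniqueness makes it \<open>Q_poly\<close>.\<close>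
  define P where "P = (\<Sum>l\<in>partitions k. Poly_Mapping.single (partition_exponent l) (partition_coeff s k n l))"
  have lookup_P: "Poly_Mapping.lookup P (partition_exponent l) = partition_coeff s k n l"
    if "l \<in> partitions k" for l
  proof -
    have "Poly_Mapping.lookup P (partition_exponent l) =
        (\<Sum>l'\<in>partitions k. if l' = l then partition_coeff s k n l' else 0)"
      unfolding P_def lookup_sum using that
      by (intro sum.cong refl) (auto simp: lookup_single when_def dest: inj_onD[OF inj_on_partition_exponent])
    then show ?thesis
      using that by (simp add: finite_partitions)
  qed
  \<comment> \<open>Only an inclusion, because coefficients may vanish, as they do for s = 0 <
    k.\<close>
  have keys_P: "Poly_Mapping.keys P \<subseteq> partition_exponent ` partitions k"
    unfolding P_def by (rule order.trans[OF keys_sum]) (auto split: if_splits)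
  have "mpoly_vars P \<subseteq> {1..k}"
    using keys_P by (fastforce simp: mpoly_vars_def keys_partition_exponent partitions_def member_le_sum_list)
  moreover have "power_sum k (subset_sums s A) = mpoly_eval (\<lambda>j. power_sum j A) P" if "size A = n" for A
  proof -
    \<comment> \<open>Evaluation runs over the distinct parts with exponents, the closed formula
      over the parts with repetition.\<close>
    have "(\<Prod>i\<in>set l. t i ^ count_list l i) = (\<Prod>j\<leftarrow>l. t j)" for l and t :: "nat \<Rightarrow> complex"
      using image_prod_mset_multiplicity[of t "mset l"]
      by (simp add: count_mset prod_mset_prod_list del: mset_map flip: mset_map)
    then have "mpoly_eval (\<lambda>j. power_sum j A) P =
        (\<Sum>l\<in>partitions k. of_rat (partition_coeff s k n l) * (\<Prod>j\<leftarrow>l. power_sum j A))"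
      by (simp add: mpoly_eval_superset[OF finite_imageI[OF finite_partitions] keys_P]
          sum.reindex[OF inj_on_partition_exponent] lookup_P keys_partition_exponent
          lookup_partition_exponent)
    then show ?thesis
      using that by (simp add: power_sum_subset_sums)
  qed
  ultimately have P: "expresses_subset_power_sum s k n P"
    by (simp add: expresses_subset_power_sum_def)
  have unique: "Q = P" if "expresses_subset_power_sum s k n Q" for Q
    using that P assms(2) by (rule expresses_subset_power_sum_unique)
  have Q_poly: "Q_poly s k n = P"
    unfolding Q_poly_def using P unique by (rule the_equality)
  have coeff: "Q_coeff s k n l = partition_coeff s k n l" if "l \<in> partitions k" for l
    using that by (simp add: Q_coeff_def Q_poly lookup_P)
  show ?thesis
  proof (intro conjI ballI)
    show "\<exists>!P. expresses_subset_power_sum s k n P"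
      using P unique by (rule ex1I)
    show "Q_poly s k n =
        (\<Sum>l\<in>partitions k. Poly_Mapping.single (partition_exponent l) (Q_coeff s k n l))"
      unfolding Q_poly P_def by (simp add: coeff)
  qed (simp only: coeff partition_coeff_def)
qed

end
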